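(* Assume $(\varphi_0,u_0,\mu_0)\in H_0^1\times H_0^1\times H$, $\eta_1\in H_0^1$, $\eta_2\in H$. Let $(\mathbf P_M^n,\mathbf Q_M^n,\mathbf U_M^n,\mathbf V_M^n)_{0\le n\le N}$ be given by the fully-discrete scheme, for $n=1,\dots,N$, $$\begin{aligned}\mathbf P_M^n=\;&\mathbf P_M^{n-1}-\Delta t\Big(\mathbf A\tfrac{\mathbf Q_M^n+\mathbf Q_M^{n-1}}2+\tfrac12\mathbf U_M^n\cdot(\mathbf Q_M^n+\mathbf Q_M^{n-1})\Big)+C_1\boldsymbol\eta_1\Delta B_1^n+\tfrac12\Delta t\,C_1\Delta B_0^n(\mathbf A\boldsymbol\eta_1+\mathbf U_M^n\cdot\boldsymbol\eta_1),\\ \mathbf Q_M^n=\;&\mathbf Q_M^{n-1}+\Delta t\Big(\mathbf A\tfrac{\mathbf P_M^n+\mathbf P_M^{n-1}}2+\tfrac12\mathbf U_M^n\cdot(\mathbf P_M^n+\mathbf P_M^{n-1})\Big)-C_1\boldsymbol\eta_1\Delta B_0^n+\tfrac12\Delta t\,C_1\Delta B_1^n(\mathbf A\boldsymbol\eta_1+\mathbf U_M^n\cdot\boldsymbol\eta_1),\\ \mathbf V_M^n=\;&\mathbf V_M^{n-1}+\tfrac12\Delta t\Big(\mathbf A\tfrac{\mathbf U_M^n+\mathbf U_M^{n-1}}2-\tfrac{\mathbf U_M^n+\mathbf U_M^{n-1}}2+\mathbf P_M^{n-1}\cdot\mathbf P_M^{n-1}+\mathbf Q_M^{n-1}\cdot\mathbf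 Q_M^{n-1}\Big)+\tfrac12C_2\boldsymbol\eta_2\Delta B_2^n\\&+\Delta t\big(C_1\mathbf P_M^{n-1}\cdot\boldsymbol\eta_1\Delta B_1^n-C_1\mathbf Q_M^{n-1}\cdot\boldsymbol\eta_1\Delta B_0^n+\Delta t\,C_1^2\boldsymbol\eta_1\cdot\boldsymbol\eta_1\big),\\ \mathbf U_M^n=\;&\mathbf U_M^{n-1}+\Delta t(\mathbf V_M^n+\mathbf V_M^{n-1})+\tfrac12\Delta t\,C_2\boldsymbol\eta_2\Delta B_2^n.\end{aligned}$$ Then, with $\mathcal N(\mathbf P,\mathbf Q)=\|\mathbf P\|_h^2+\|\mathbf Q\|_h^2$, for every $n\in\{0,1,\dots,N\}$, $$\mathbb{E}[\mathcal N(\mathbf P_M^n,\mathbf Q_M^n)]=\mathbb{E}[\mathcal N(\mathbf P_M^0,\mathbf Q_M^0)]+2C_1^2\|\boldsymbol\eta_1\|_h^2\,t_n.$$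
   Context: $H=L^2([a,b])$ and $H_0^1$ is the space of $H^1([a,b])$ functions vanishing at $a,b$. $C_1,C_2\in\mathbb{R}$; $B_0,B_1,B_2$ are independent standard real Wiener processes; $\eta_1,\eta_2$ are sufficiently smooth real-valued functions on $[a,b]$. $M$ is a positive integer, $h=(b-a)/M$, $x_i=a+ih$, and $\boldsymbol\eta_k=(\eta_k(x_1),\dots,\eta_k(x_{M-1}))^\top$ for $k=1,2$. $\mathbf A$ is the $(M-1)\times(M-1)$ tridiagonal matrix $h^{-2}\,\mathrm{tridiag}(1,-2,1)$. For $T>0$ and time step $\Delta t$, $t_n=n\Delta t$, $N=[T/\Delta t]$, and $\Delta B_k^n=B_k(t_n)-B_k(t_{n-1})$ for $k=0,1,2$. For vectors in $\mathbb{R}^{M-1}$, $\cdot$ denotes the componentwise product, $\langle f,g\rangle_h=h\sum_{i=1}^{M-1}\operatorname{Re}(f_i\bar g_i)$ and $\|f\|_h=\sqrt{\langle f,f\rangle_h}$. The initial vectors $\mathbf P_M^0,\mathbf Q_M^0,\mathbf U_M^0,\mathbf V_M^0\in\mathbb{R}^{M-1}$ are the approximations at the grid points $x_1,\dots,x_{M-1}$ of $\operatorname{Re}\varphi_0,\operatorname{Im}\varphi_0,u_0,\tfrac12\mu_0$. The scheme approximates the stochastic Klein--Gordon--Schrödinger equation with initial data $\varphi_0$ (complex-valued), $u_0$, $\mu_0$ (real-valued) and homogeneous Dirichlet boundary conditions. *)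

theory Defs
  imports "HOL-Probability.Probability"
begin

text \<open>Elements of the function spaces are represented by functions on the real line of which
  only the restriction to \<open>[a,b]\<close> matters.\<close>

definition L2_on :: "real \<Rightarrow> real \<Rightarrow> (real \<Rightarrow> 'a::{banach, second_countable_topology}) \<Rightarrow> bool" where
  "L2_on a b f \<longleftrightarrow>
     f \<in> borel_measurable (lebesgue_on {a..b}) \<and>
     integrable (lebesgue_on {a..b}) (\<lambda>x. (norm (f x))\<^sup>2)"

definition test_function :: "real \<Rightarrow> real \<Rightarrow> (real \<Rightarrow> real) \<Rightarrow> bool" where
  "test_function a b \<phi> \<longleftrightarrow>
     (\<forall>k x. (deriv ^^ k) \<phi> differentiable (at x)) \<and>
     (\<exists>c d. a < c \<and> d < b \<and> (\<forall>x. x \<notin> {c..d} \<longrightarrow> \<phi> x = 0))"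

definition weak_deriv ::
  "real \<Rightarrow> real \<Rightarrow> (real \<Rightarrow> 'a::{banach, second_countable_topology}) \<Rightarrow> (real \<Rightarrow> 'a) \<Rightarrow> bool" where
  "weak_deriv a b f g \<longleftrightarrow>
     (\<forall>\<phi>. test_function a b \<phi> \<longrightarrow>
        (LINT x|lebesgue_on {a..b}. deriv \<phi> x *\<^sub>R f x) =
        - (LINT x|lebesgue_on {a..b}. \<phi> x *\<^sub>R g x))"

definition H1_on :: "real \<Rightarrow> real \<Rightarrow> (real \<Rightarrow> 'a::{banach, second_countable_topology}) \<Rightarrow> bool" where
  "H1_on a b f \<longleftrightarrow> L2_on a b f \<and> (\<exists>g. L2_on a b g \<and> weak_deriv a b f g)"

text \<open>Boundary values (and grid values) of an \<open>H\<^sup>1\<close> function are those of its continuous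
  representative; the continuity requirement selects it.\<close>

definition H10_on :: "real \<Rightarrow> real \<Rightarrow> (real \<Rightarrow> 'a::{banach, second_countable_topology}) \<Rightarrow> bool" where
  "H10_on a b f \<longleftrightarrow> H1_on a b f \<and> continuous_on {a..b} f \<and> f a = 0 \<and> f b = 0"

text \<open>Time is a real parameter; only the values at times \<open>t \<ge> 0\<close> are relevant.\<close>

definition std_wiener :: "'w measure \<Rightarrow> (real \<Rightarrow> 'w \<Rightarrow> real) \<Rightarrow> bool" where
  "std_wiener \<Omega> B \<longleftrightarrow>
     (\<forall>t\<ge>0. B t \<in> borel_measurable \<Omega>) \<and>
     (AE \<omega> in \<Omega>. B 0 \<omega> = 0) \<and>
     (\<forall>(k::nat) t. 0 \<le> t 0 \<and> (\<forall>i<k. t i \<le> t (Suc i)) \<longrightarrow>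
        prob_space.indep_vars \<Omega> (\<lambda>_. borel) (\<lambda>i \<omega>. B (t (Suc i)) \<omega> - B (t i) \<omega>) {..<k}) \<and>
     (\<forall>s t. 0 \<le> s \<and> s < t \<longrightarrow>
        distributed \<Omega> lborel (\<lambda>\<omega>. B t \<omega> - B s \<omega>) (normal_density 0 (sqrt (t - s)))) \<and>
     (AE \<omega> in \<Omega>. continuous_on {0..} (\<lambda>t. B t \<omega>))"

text \<open>Joint independence of a family of whole processes, i.e. of the sigma-algebras generated
  by all their values at times \<open>t \<ge> 0\<close>.\<close>

definition indep_processes :: "'w measure \<Rightarrow> ('k \<Rightarrow> real \<Rightarrow> 'w \<Rightarrow> real) \<Rightarrow> 'k set \<Rightarrow> bool" where
  "indep_processes \<Omega> B K \<longleftrightarrow>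
     prob_space.indep_vars \<Omega> (\<lambda>_. Pi\<^sub>M {0..} (\<lambda>_. borel)) (\<lambda>k \<omega>. \<lambda>t\<in>{0..}. B k t \<omega>) K"

text \<open>A vector of \<open>\<real>\<^sup>m\<^sup>-\<^sup>1\<close> is a function on the naturals of which only the components with index
  in \<open>{1..<m}\<close> matter; matrices are treated in the same way.\<close>

definition lap_mat :: "real \<Rightarrow> nat \<Rightarrow> nat \<Rightarrow> real" where
  "lap_mat h i j =
     (if i = j then - 2 / h\<^sup>2 else if i = Suc j \<or> j = Suc i then 1 / h\<^sup>2 else 0)"

definition mat_vec :: "nat \<Rightarrow> (nat \<Rightarrow> nat \<Rightarrow> real) \<Rightarrow> (nat \<Rightarrow> real) \<Rightarrow> nat \<Rightarrow> real" where
  "mat_vec m A f i = (\<Sum>j\<in>{1..<m}. A i j * f j)"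

text \<open>For real vectors, \<open>Re (f\<^sub>i * cnj g\<^sub>i)\<close> is the product \<open>f\<^sub>i * g\<^sub>i\<close>.\<close>

definition inner_h :: "nat \<Rightarrow> real \<Rightarrow> (nat \<Rightarrow> real) \<Rightarrow> (nat \<Rightarrow> real) \<Rightarrow> real" where
  "inner_h m h f g = h * (\<Sum>i\<in>{1..<m}. f i * g i)"

definition norm_h :: "nat \<Rightarrow> real \<Rightarrow> (nat \<Rightarrow> real) \<Rightarrow> real" where
  "norm_h m h f = sqrt (inner_h m h f f)"

definition charge :: "nat \<Rightarrow> real \<Rightarrow> (nat \<Rightarrow> real) \<Rightarrow> (nat \<Rightarrow> real) \<Rightarrow> real" where
  "charge m h P Q = (norm_h m h P)\<^sup>2 + (norm_h m h Q)\<^sup>2"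

text \<open>One step of the scheme, written componentwise, from \<open>(p, q, u, v)\<close> (old values) to
  \<open>(P, Q, U, V)\<close> (new values). The arguments \<open>e1, e2\<close> are the grid vectors of \<open>\<eta>\<^sub>1, \<eta>\<^sub>2\<close>, and
  \<open>b0, b1, b2\<close> are the increments of the three Wiener processes over the time step \<open>dt\<close>.\<close>

definition kgs_step ::
  "nat \<Rightarrow> real \<Rightarrow> real \<Rightarrow> real \<Rightarrow> real \<Rightarrow> (nat \<Rightarrow> real) \<Rightarrow> (nat \<Rightarrow> real) \<Rightarrow> real \<Rightarrow> real \<Rightarrow> real \<Rightarrow>
   (nat \<Rightarrow> real) \<Rightarrow> (nat \<Rightarrow> real) \<Rightarrow> (nat \<Rightarrow> real) \<Rightarrow> (nat \<Rightarrow> real) \<Rightarrow>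
   (nat \<Rightarrow> real) \<Rightarrow> (nat \<Rightarrow> real) \<Rightarrow> (nat \<Rightarrow> real) \<Rightarrow> (nat \<Rightarrow> real) \<Rightarrow> bool" where
  "kgs_step m h dt C1 C2 e1 e2 b0 b1 b2 p q u v P Q U V \<longleftrightarrow>
     (let A = mat_vec m (lap_mat h) in \<forall>i\<in>{1..<m}.
        P i = p i
          - dt * (A (\<lambda>j. (Q j + q j) / 2) i + 1/2 * U i * (Q i + q i))
          + C1 * e1 i * b1
          + 1/2 * dt * C1 * b0 * (A e1 i + U i * e1 i) \<and>
        Q i = q i
          + dt * (A (\<lambda>j. (P j + p j) / 2) i + 1/2 * U i * (P i + p i))
          - C1 * e1 i * b0
          + 1/2 * dt * C1 * b1 * (A e1 i + U i * e1 i) \<and>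
        V i = v i
          + 1/2 * dt * (A (\<lambda>j. (U j + u j) / 2) i - (U i + u i) / 2 + p i * p i + q i * q i)
          + 1/2 * C2 * e2 i * b2
          + dt * (C1 * p i * e1 i * b1 - C1 * q i * e1 i * b0 + dt * C1\<^sup>2 * (e1 i * e1 i)) \<and>
        U i = u i + dt * (V i + v i) + 1/2 * dt * C2 * e2 i * b2)"

end

theory Submission
  imports Defs
begin

text \<open>Writing \<open>(p, q)\<close> for the old values, one step of the scheme first kicks them to
  \<open>(p + C\<^sub>1 e\<^sub>1 \<Delta>B\<^sub>1, q - C\<^sub>1 e\<^sub>1 \<Delta>B\<^sub>0)\<close> and then applies a Cayley transform of the symmetric operator
  \<open>A + U\<close>, which preserves the charge. The kick adds \<open>2 C\<^sub>1\<^sup>2 \<parallel>e\<^sub>1\<parallel>\<^sup>2 dt\<close> to the expectation, since the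
  cross terms have mean zero: \<open>(p, q)\<close> is independent of the new increments. That in turn holds
  because the implicit equations are uniquely solvable with a measurable solution, so \<open>(p, q)\<close> is
  almost surely a function of the past increments.\<close>

section \<open>Measurability of solutions of coercive linear systems\<close>

text \<open>The noise terms \<open>1/2 * dt * C1 * b * (A e1 + U * e1)\<close> of the scheme are, up
  to sign, \<open>dt / 2\<close> times \<open>A + U\<close> applied to the kick: they turn the
  average of old and new values into the average of kicked and new values. The new \<open>U\<close>
  does depend on the current increments, but it enters only through a symmetric operator, so the
  charge balance holds path by path and no correlation with \<open>U\<close> has to be estimated.
  The obstacle is independence: the solution is only known to be random vectors that satisfy
  implicit equations almost surely. Uniqueness settles this, since whatever solves a step must agree
  with one fixed measurable function of the data. It requires no smallness of \<open>dt\<close>: the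
  systems have the form \<open>I + K\<close> with \<open>K\<close> positive semidefinite for
  \<open>U\<close> and skew for \<open>(P, Q)\<close>. The 2 in the growth rate counts the two
  processes \<open>B 0\<close> and \<open>B 1\<close>.\<close>

lemma psd_residual_bound:
  fixes d :: "'i \<Rightarrow> real" and k :: "'i \<Rightarrow> 'i \<Rightarrow> real"
  assumes fin: "finite I"
    and psd: "0 \<le> (\<Sum>i\<in>I. \<Sum>j\<in>I. k i j * d j * d i)"
  shows "L2_set d I \<le> L2_set (\<lambda>i. d i + (\<Sum>j\<in>I. k i j * d j)) I"
proof -
  \<comment> \<open>\<open>R\<close> is \<open>(I + K) d\<close>; its pairing with \<open>d\<close>
    is at least the squared norm of \<open>d\<close>, and Cauchy-Schwarz bounds it from above. Only
    the quadratic form matters, so \<open>K\<close> may be skew.\<close>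
  define R where "R i = d i + (\<Sum>j\<in>I. k i j * d j)" for i
  have nn: "0 \<le> (\<Sum>i\<in>I. (d i)\<^sup>2)" by (intro sum_nonneg) simp
  have "(L2_set d I)\<^sup>2 = (\<Sum>i\<in>I. (d i)\<^sup>2)"
    unfolding L2_set_def using nn by simp
  also have "\<dots> \<le> (\<Sum>i\<in>I. (d i)\<^sup>2) + (\<Sum>i\<in>I. \<Sum>j\<in>I. k i j * d j * d i)"
    using psd by simp
  also have "\<dots> = (\<Sum>i\<in>I. R i * d i)"
    by (simp add: R_def power2_eq_square algebra_simps sum.distrib sum_distrib_left)
  also have "\<dots> \<le> (\<Sum>i\<in>I. \<bar>R i\<bar> * \<bar>d i\<bar>)"
    by (intro sum_mono) (metis abs_ge_self abs_mult)
  also have "\<dots> \<le> L2_set R I * L2_set d I" by (rule L2_set_mult_ineq)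
  finally have *: "L2_set d I * L2_set d I \<le> L2_set R I * L2_set d I"
    by (simp add: power2_eq_square)
  show ?thesis
  proof (cases "L2_set d I = 0")
    case True
    then show ?thesis by simp
  next
    case False
    then have "0 < L2_set d I" using L2_set_nonneg[of d I] by linarith
    then have "L2_set d I \<le> L2_set R I" using * by simp
    then show ?thesis by (simp add: R_def[abs_def])
  qed
qed

lemma ex_rat_seq: "\<exists>q::nat \<Rightarrow> real. range q \<subseteq> \<rat> \<and> q \<longlonglongrightarrow> z"
proof -
  have "\<exists>q\<in>\<rat>. z < q \<and> q < z + 1 / real (Suc n)" for n
    by (rule Rats_dense_in_real) simp
  then obtain q where q: "\<And>n. q n \<in> \<rat>" "\<And>n. z < q n" "\<And>n. q n < z + 1 / real (Suc n)"
    by metis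
  have "(\<lambda>n. z + 1 / real (Suc n)) \<longlonglongrightarrow> z + 0"
    by (intro tendsto_intros LIMSEQ_Suc lim_1_over_n)
  then have "q \<longlonglongrightarrow> z"
    using q by (intro tendsto_sandwich[of "\<lambda>_. z" q sequentially "\<lambda>n. z + 1 / real (Suc n)"])
      (auto intro!: always_eventually less_imp_le)
  with q show ?thesis by blast
qed

text \<open>Since \<open>K\<close> is positive semidefinite, the error of a trial vector \<open>r\<close> is bounded by the norm of
  its residual \<open>F r\<close>. Hence \<open>z\<^sub>i\<close> is the infimum of \<open>r\<^sub>i + F r\<close> over the countably many rational
  \<open>r\<close>, which is measurable without any formula for the inverse of \<open>I + K\<close>.\<close>

lemma psd_solution_measurable:
  fixes k :: "'a \<Rightarrow> 'i \<Rightarrow> 'i \<Rightarrow> real" and c :: "'a \<Rightarrow> 'i \<Rightarrow> real"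
  assumes fin: "finite I"
    and k: "\<And>i j. i \<in> I \<Longrightarrow> j \<in> I \<Longrightarrow> (\<lambda>\<omega>. k \<omega> i j) \<in> borel_measurable M"
    and c: "\<And>i. i \<in> I \<Longrightarrow> (\<lambda>\<omega>. c \<omega> i) \<in> borel_measurable M"
    and psd: "\<And>\<omega> d. \<omega> \<in> space M \<Longrightarrow> 0 \<le> (\<Sum>i\<in>I. \<Sum>j\<in>I. k \<omega> i j * d j * d i)"
  obtains s where "\<And>i. i \<in> I \<Longrightarrow> (\<lambda>\<omega>. s \<omega> i) \<in> borel_measurable M"
    and "\<And>\<omega> z i. \<omega> \<in> space M \<Longrightarrow> (\<And>i. i \<in> I \<Longrightarrow> z i + (\<Sum>j\<in>I. k \<omega> i j * z j) = c \<omega> i) \<Longrightarrow>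
           i \<in> I \<Longrightarrow> z i = s \<omega> i"
proof
  \<comment> \<open>Extensional functions: fixing the values off \<open>I\<close> keeps the set of
    rational trial vectors countable.\<close>
  define D :: "('i \<Rightarrow> real) set" where "D = (I \<rightarrow>\<^sub>E \<rat>)"
  define F where "F r \<omega> = L2_set (\<lambda>i. r i + (\<Sum>j\<in>I. k \<omega> i j * r j) - c \<omega> i) I" for r \<omega>
  define s where "s \<omega> i = real_of_ereal (INF r\<in>D. ereal (r i + F r \<omega>))" for \<omega> i
  have D: "countable D" unfolding D_def using fin countable_rat by (intro countable_PiE) auto
  have [measurable]: "F r \<in> borel_measurable M" for r
    unfolding F_def L2_set_def using k c by measurable
  show "(\<lambda>\<omega>. s \<omega> i) \<in> borel_measurable M" if "i \<in> I" for i
    unfolding s_def using D by measurable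
  fix \<omega> z i
  assume \<omega>: "\<omega> \<in> space M" and z: "\<And>i. i \<in> I \<Longrightarrow> z i + (\<Sum>j\<in>I. k \<omega> i j * z j) = c \<omega> i"
    and i: "i \<in> I"
  have res: "F r \<omega> = L2_set (\<lambda>i. (r i - z i) + (\<Sum>j\<in>I. k \<omega> i j * (r j - z j))) I" for r
    unfolding F_def
    by (intro L2_set_cong refl) (simp add: z[symmetric] algebra_simps sum_subtractf)
  have lower: "z i \<le> r i + F r \<omega>" for r
  proof -
    have "z i - r i \<le> \<bar>r i - z i\<bar>" by simp
    also have "\<dots> \<le> L2_set (\<lambda>i. \<bar>r i - z i\<bar>) I"
      using fin i by (rule member_le_L2_set)
    also have "\<dots> = L2_set (\<lambda>i. r i - z i) I" by (simp add: L2_set_def)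
    also have "\<dots> \<le> F r \<omega>"
      unfolding res by (intro psd_residual_bound fin psd \<omega>)
    finally show ?thesis by simp
  qed
  have "\<forall>j. \<exists>q::nat \<Rightarrow> real. range q \<subseteq> \<rat> \<and> q \<longlonglongrightarrow> z j"
    using ex_rat_seq by blast
  from choice[OF this] obtain q where q: "\<And>j. range (q j) \<subseteq> \<rat>" "\<And>j. q j \<longlonglongrightarrow> z j"
    by blast
  define r where "r n = restrict (\<lambda>j. q j n) I" for n
  have rD: "r n \<in> D" for n unfolding r_def D_def using q(1) by auto
  have rlim: "(\<lambda>n. r n j) \<longlonglongrightarrow> z j" if "j \<in> I" for j
    using q(2)[of j] that by (simp add: r_def)
  \<comment> \<open>Along rational vectors tending to \<open>z\<close> the residual tends to that of
    \<open>z\<close>, which is zero, so the lower bound is approached.\<close>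
  have "(\<lambda>n. r n i + F (r n) \<omega>) \<longlonglongrightarrow>
      z i + L2_set (\<lambda>i. (z i - z i) + (\<Sum>j\<in>I. k \<omega> i j * (z j - z j))) I"
    unfolding res L2_set_def by (intro tendsto_intros rlim i)
  then have lim: "(\<lambda>n. ereal (r n i + F (r n) \<omega>)) \<longlonglongrightarrow> ereal (z i)"
    by (simp add: L2_set_def)
  have "(INF r\<in>D. ereal (r i + F r \<omega>)) = ereal (z i)"
  proof (rule antisym)
    show "(INF r\<in>D. ereal (r i + F r \<omega>)) \<le> ereal (z i)"
      using lim by (rule LIMSEQ_le_const) (auto intro!: INF_lower rD)
    show "ereal (z i) \<le> (INF r\<in>D. ereal (r i + F r \<omega>))"
      using lower by (intro INF_greatest) simp
  qed
  then show "z i = s \<omega> i" by (simp add: s_def)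
qed

section \<open>The scheme as a linear system\<close>

lemma lap_mat_sym: "lap_mat h i j = lap_mat h j i"
  by (auto simp: lap_mat_def)

text \<open>Interior rows sum to zero; the first and the last row lack a neighbour because of the
  Dirichlet condition.\<close>

lemma lap_mat_row_sum_nonpos:
  assumes i: "i \<in> {1..<m}"
  shows "(\<Sum>j\<in>{1..<m}. lap_mat h i j) \<le> 0"
proof -
  have "(\<Sum>j\<in>{1..<m}. lap_mat h i j) =
      1 / h\<^sup>2 * (\<Sum>j\<in>{1..<m}. (if j = Suc i then 1 else 0) + (if j = i - 1 \<and> 0 < i then 1 else 0)
        - (if j = i then 2 else 0))"
    unfolding sum_distrib_left by (intro sum.cong refl) (auto simp: lap_mat_def)
  also have "\<dots> = 1 / h\<^sup>2 * ((if Suc i \<in> {1..<m} then 1 else 0)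
      + (if i - 1 \<in> {1..<m} \<and> 0 < i then 1 else 0) - (if i \<in> {1..<m} then 2 else 0))"
    using i by (simp_all add: sum.distrib sum_subtractf)
  also have "\<dots> \<le> 0"
    using i by (intro mult_nonneg_nonpos) auto
  finally show ?thesis .
qed

text \<open>Off-diagonal entries are nonnegative, so
  \<open>2 * f i * f j \<le> (f i)\<^sup>2 + (f j)\<^sup>2\<close> may be weighted with them, while
  the diagonal gives equality. By symmetry the bound collapses to row sums weighted with
  \<open>(f i)\<^sup>2\<close>.\<close>

lemma lap_mat_nsd: "(\<Sum>i\<in>{1..<m}. \<Sum>j\<in>{1..<m}. lap_mat h i j * f j * f i) \<le> 0"
proof -
  let ?I = "{1..<m}"
  have "(\<Sum>i\<in>?I. \<Sum>j\<in>?I. lap_mat h i j * f j * f i)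
      \<le> (\<Sum>i\<in>?I. \<Sum>j\<in>?I. lap_mat h i j * (f i)\<^sup>2 / 2 + lap_mat h i j * (f j)\<^sup>2 / 2)"
  proof (intro sum_mono)
    fix i j
    show "lap_mat h i j * f j * f i \<le> lap_mat h i j * (f i)\<^sup>2 / 2 + lap_mat h i j * (f j)\<^sup>2 / 2"
    proof (cases "i = j")
      case True
      then show ?thesis by (simp add: power2_eq_square)
    next
      case False
      then have "0 \<le> lap_mat h i j" by (simp add: lap_mat_def)
      moreover have "f j * f i \<le> ((f i)\<^sup>2 + (f j)\<^sup>2) / 2"
        using sum_squares_bound[of "f j" "f i"] by (simp add: algebra_simps)
      ultimately have "lap_mat h i j * (f j * f i) \<le> lap_mat h i j * (((f i)\<^sup>2 + (f j)\<^sup>2) / 2)"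
        by (intro mult_left_mono)
      then show ?thesis by (simp add: algebra_simps add_divide_distrib)
    qed
  qed
  also have "\<dots> = (\<Sum>i\<in>?I. \<Sum>j\<in>?I. lap_mat h i j * (f i)\<^sup>2 / 2)
      + (\<Sum>i\<in>?I. \<Sum>j\<in>?I. lap_mat h i j * (f j)\<^sup>2 / 2)"
    by (simp add: sum.distrib)
  also have "(\<Sum>i\<in>?I. \<Sum>j\<in>?I. lap_mat h i j * (f j)\<^sup>2 / 2)
      = (\<Sum>i\<in>?I. \<Sum>j\<in>?I. lap_mat h i j * (f i)\<^sup>2 / 2)"
    by (subst sum.swap) (simp add: lap_mat_sym)
  also have "(\<Sum>i\<in>?I. \<Sum>j\<in>?I. lap_mat h i j * (f i)\<^sup>2 / 2) + (\<Sum>i\<in>?I. \<Sum>j\<in>?I. lap_mat h i j * (f i)\<^sup>2 / 2)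
      = (\<Sum>i\<in>?I. (f i)\<^sup>2 * (\<Sum>j\<in>?I. lap_mat h i j))"
    by (simp add: sum.distrib[symmetric] sum_distrib_left mult.commute)
  also have "\<dots> \<le> 0"
    by (intro sum_nonpos mult_nonneg_nonpos lap_mat_row_sum_nonpos) auto
  finally show ?thesis .
qed

lemma mat_vec_cong: "(\<And>j. j \<in> {1..<m} \<Longrightarrow> f j = g j) \<Longrightarrow> mat_vec m A f = mat_vec m A g"
  unfolding mat_vec_def by (intro ext sum.cong) auto

lemma lap_mat_self_adjoint:
  "(\<Sum>i\<in>{1..<m}. mat_vec m (lap_mat h) f i * g i) = (\<Sum>i\<in>{1..<m}. mat_vec m (lap_mat h) g i * f i)"
proof -
  have "(\<Sum>i\<in>{1..<m}. mat_vec m (lap_mat h) f i * g i)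
      = (\<Sum>i\<in>{1..<m}. \<Sum>j\<in>{1..<m}. lap_mat h i j * f j * g i)"
    by (simp add: mat_vec_def sum_distrib_right)
  also have "\<dots> = (\<Sum>i\<in>{1..<m}. \<Sum>j\<in>{1..<m}. lap_mat h j i * f i * g j)"
    by (rule sum.swap)
  also have "\<dots> = (\<Sum>i\<in>{1..<m}. mat_vec m (lap_mat h) g i * f i)"
    by (simp add: mat_vec_def sum_distrib_right sum_distrib_left lap_mat_sym[of h] mult_ac)
  finally show ?thesis .
qed

section \<open>Charge balance and solution map of a single step\<close>

lemma charge_eq: "0 \<le> h \<Longrightarrow> charge m h P Q = h * (\<Sum>i\<in>{1..<m}. (P i)\<^sup>2 + (Q i)\<^sup>2)"
  by (simp add: charge_def norm_h_def inner_h_def sum_nonneg sum.distrib distrib_left power2_eq_square)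

lemma kgs_stepD:
  assumes "kgs_step m h dt C1 C2 e1 e2 b0 b1 b2 p q u v P Q U V" and "i \<in> {1..<m}"
  shows "P i = p i
      - dt * (mat_vec m (lap_mat h) (\<lambda>j. (Q j + q j) / 2) i + 1/2 * U i * (Q i + q i))
      + C1 * e1 i * b1 + 1/2 * dt * C1 * b0 * (mat_vec m (lap_mat h) e1 i + U i * e1 i)"
    and "Q i = q i
      + dt * (mat_vec m (lap_mat h) (\<lambda>j. (P j + p j) / 2) i + 1/2 * U i * (P i + p i))
      - C1 * e1 i * b0 + 1/2 * dt * C1 * b1 * (mat_vec m (lap_mat h) e1 i + U i * e1 i)"
    and "V i = v i
      + 1/2 * dt * (mat_vec m (lap_mat h) (\<lambda>j. (U j + u j) / 2) i - (U i + u i) / 2 + p i * p i + q i * q i)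
      + 1/2 * C2 * e2 i * b2
      + dt * (C1 * p i * e1 i * b1 - C1 * q i * e1 i * b0 + dt * C1\<^sup>2 * (e1 i * e1 i))"
    and "U i = u i + dt * (V i + v i) + 1/2 * dt * C2 * e2 i * b2"
  using bspec[OF assms(1)[unfolded kgs_step_def Let_def] assms(2)] by blast+

text \<open>With \<open>p' = p + C\<^sub>1 e\<^sub>1 b\<^sub>1\<close>, \<open>q' = q - C\<^sub>1 e\<^sub>1 b\<^sub>0\<close> and \<open>L = A + U\<close>, the step reads
  \<open>P - p' = - dt/2 L (Q + q')\<close>, \<open>Q - q' = dt/2 L (P + p')\<close>. Pairing with \<open>P + p'\<close> and \<open>Q + q'\<close>
  cancels the right-hand sides, as \<open>L\<close> is symmetric.\<close>

lemma kgs_step_charge: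
  assumes step: "kgs_step m h dt C1 C2 e1 e2 b0 b1 b2 p q u v P Q U V" and h: "0 \<le> h"
  shows "charge m h P Q = charge m h (\<lambda>i. p i + C1 * e1 i * b1) (\<lambda>i. q i - C1 * e1 i * b0)"
proof -
  let ?A = "mat_vec m (lap_mat h)"
  define p' where "p' i = p i + C1 * e1 i * b1" for i
  define q' where "q' i = q i - C1 * e1 i * b0" for i
  define x where "x i = P i + p' i" for i
  define y where "y i = Q i + q' i" for i
  \<comment> \<open>The summands with \<open>e1\<close> come from the kick; they match the
    \<open>1/2 * dt\<close> noise terms of the scheme.\<close>
  have Ax: "?A x i = 2 * ?A (\<lambda>j. (P j + p j) / 2) i + C1 * b1 * ?A e1 i" for i
    unfolding mat_vec_def sum_distrib_left sum.distrib[symmetric]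
    by (intro sum.cong refl) (simp add: x_def p'_def algebra_simps)
  have Ay: "?A y i = 2 * ?A (\<lambda>j. (Q j + q j) / 2) i - C1 * b0 * ?A e1 i" for i
    unfolding mat_vec_def sum_distrib_left sum_subtractf[symmetric]
    by (intro sum.cong refl) (simp add: y_def q'_def algebra_simps)
  have P: "P i = p' i - dt / 2 * (?A y i + U i * y i)"
    and Q: "Q i = q' i + dt / 2 * (?A x i + U i * x i)" if "i \<in> {1..<m}" for i
  proof -
    note eqs = kgs_stepD[OF step that]
    have alg: "r - dt * (a + 1/2 * w * s) + k + 1/2 * dt * C1 * b * (c + w * e)
        = (r + k) - dt / 2 * (2 * a - C1 * b * c + w * (s - C1 * e * b))"
      "r + dt * (a + 1/2 * w * s) - k + 1/2 * dt * C1 * b * (c + w * e)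
        = (r - k) + dt / 2 * (2 * a + C1 * b * c + w * (s + C1 * e * b))"
      for r a w s k b c e :: real
      by (simp_all add: algebra_simps)
    show "P i = p' i - dt / 2 * (?A y i + U i * y i)"
      unfolding Ay by (subst eqs(1), subst alg) (simp add: y_def q'_def p'_def algebra_simps)
    show "Q i = q' i + dt / 2 * (?A x i + U i * x i)"
      unfolding Ax by (subst eqs(2), subst alg) (simp add: x_def q'_def p'_def algebra_simps)
  qed
  have "(\<Sum>i\<in>{1..<m}. (P i)\<^sup>2 + (Q i)\<^sup>2) - (\<Sum>i\<in>{1..<m}. (p' i)\<^sup>2 + (q' i)\<^sup>2)
      = (\<Sum>i\<in>{1..<m}. (P i - p' i) * x i + (Q i - q' i) * y i)"
    by (simp add: sum_subtractf[symmetric] x_def y_def power2_eq_square algebra_simps)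
  \<comment> \<open>The term \<open>U i * x i * y i\<close> occurs with both signs and cancels at
    each grid point, whatever \<open>U\<close> is; only \<open>A\<close> needs the
    summation.\<close>
  also have "\<dots> = (\<Sum>i\<in>{1..<m}. dt / 2 * (?A x i * y i) - dt / 2 * (?A y i * x i))"
  proof (intro sum.cong refl)
    fix i assume "i \<in> {1..<m}"
    from P[OF this] Q[OF this]
    have *: "P i - p' i = - (dt / 2 * (?A y i + U i * y i))"
      and **: "Q i - q' i = dt / 2 * (?A x i + U i * x i)" by simp_all
    show "(P i - p' i) * x i + (Q i - q' i) * y i
        = dt / 2 * (?A x i * y i) - dt / 2 * (?A y i * x i)"
      unfolding * ** by (simp add: algebra_simps)
  qed
  also have "\<dots> = 0"
    unfolding sum_subtractf sum_distrib_left[symmetric] by (simp only: lap_mat_self_adjoint[of m h x y])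
  finally show ?thesis
    using h by (simp add: charge_eq p'_def q'_def)
qed

text \<open>The old values are known to be functions of the increments only at indices in
  \<open>{1..<m}\<close>, so they cannot be replaced as whole functions.\<close>

lemma kgs_step_cong:
  assumes "\<And>i. i \<in> {1..<m} \<Longrightarrow> p i = p' i" "\<And>i. i \<in> {1..<m} \<Longrightarrow> q i = q' i"
    and "\<And>i. i \<in> {1..<m} \<Longrightarrow> u i = u' i" "\<And>i. i \<in> {1..<m} \<Longrightarrow> v i = v' i"
  shows "kgs_step m h dt C1 C2 e1 e2 b0 b1 b2 p q u v P Q U V \<longleftrightarrow>
    kgs_step m h dt C1 C2 e1 e2 b0 b1 b2 p' q' u' v' P Q U V"
proof -
  have "mat_vec m (lap_mat h) (\<lambda>j. (Q j + q j) / 2) = mat_vec m (lap_mat h) (\<lambda>j. (Q j + q' j) / 2)"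
    "mat_vec m (lap_mat h) (\<lambda>j. (P j + p j) / 2) = mat_vec m (lap_mat h) (\<lambda>j. (P j + p' j) / 2)"
    "mat_vec m (lap_mat h) (\<lambda>j. (U j + u j) / 2) = mat_vec m (lap_mat h) (\<lambda>j. (U j + u' j) / 2)"
    by (intro mat_vec_cong; simp add: assms)+
  then show ?thesis
    unfolding kgs_step_def Let_def using assms by (intro ball_cong refl) simp
qed

text \<open>\<open>M\<close> is left arbitrary because it will be the product space of increment
  values rather than the probability space; the new values thereby become functions of the
  increments.\<close>

lemma kgs_step_solution_measurable:
  fixes p q u v :: "'a \<Rightarrow> nat \<Rightarrow> real" and b0 b1 b2 :: "'a \<Rightarrow> real"
  assumes meas: "\<And>i. i \<in> {1..<m} \<Longrightarrow> (\<lambda>\<omega>. p \<omega> i) \<in> borel_measurable M"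
      "\<And>i. i \<in> {1..<m} \<Longrightarrow> (\<lambda>\<omega>. q \<omega> i) \<in> borel_measurable M"
      "\<And>i. i \<in> {1..<m} \<Longrightarrow> (\<lambda>\<omega>. u \<omega> i) \<in> borel_measurable M"
      "\<And>i. i \<in> {1..<m} \<Longrightarrow> (\<lambda>\<omega>. v \<omega> i) \<in> borel_measurable M"
    and [measurable]: "b0 \<in> borel_measurable M" "b1 \<in> borel_measurable M" "b2 \<in> borel_measurable M"
  obtains P' Q' U' V' where
    "\<And>i. i \<in> {1..<m} \<Longrightarrow> (\<lambda>\<omega>. P' \<omega> i) \<in> borel_measurable M"
    "\<And>i. i \<in> {1..<m} \<Longrightarrow> (\<lambda>\<omega>. Q' \<omega> i) \<in> borel_measurable M"
    "\<And>i. i \<in> {1..<m} \<Longrightarrow> (\<lambda>\<omega>. U' \<omega> i) \<in> borel_measurable M"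
    "\<And>i. i \<in> {1..<m} \<Longrightarrow> (\<lambda>\<omega>. V' \<omega> i) \<in> borel_measurable M"
    "\<And>\<omega> P Q U V i. \<omega> \<in> space M \<Longrightarrow>
       kgs_step m h dt C1 C2 e1 e2 (b0 \<omega>) (b1 \<omega>) (b2 \<omega>) (p \<omega>) (q \<omega>) (u \<omega>) (v \<omega>) P Q U V \<Longrightarrow>
       i \<in> {1..<m} \<Longrightarrow> P i = P' \<omega> i \<and> Q i = Q' \<omega> i \<and> U i = U' \<omega> i \<and> V i = V' \<omega> i"
proof -
  let ?I = "{1..<m}"
  let ?A = "mat_vec m (lap_mat h)"
  note [measurable] = meas
  have A_meas [measurable]: "(\<lambda>\<omega>. ?A (f \<omega>) i) \<in> borel_measurable M"
    if "\<And>j. j \<in> ?I \<Longrightarrow> (\<lambda>\<omega>. f \<omega> j) \<in> borel_measurable M" for f :: "'a \<Rightarrow> nat \<Rightarrow> real" and i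
    unfolding mat_vec_def using that by measurable
  define w where "w \<omega> i = dt * (C1 * p \<omega> i * e1 i * b1 \<omega> - C1 * q \<omega> i * e1 i * b0 \<omega>
      + dt * C1\<^sup>2 * (e1 i * e1 i))" for \<omega> i
  have w [measurable]: "(\<lambda>\<omega>. w \<omega> i) \<in> borel_measurable M" if "i \<in> ?I" for i
    unfolding w_def using that by measurable
  text \<open>Eliminating \<open>V\<close> leaves a linear system for \<open>U\<close>, and once \<open>U\<close> is known the equations for
    \<open>(P, Q)\<close> are linear with a skew-symmetric matrix.\<close>
  define kU where "kU i j = dt\<^sup>2 / 4 * ((if i = j then 1 else 0) - lap_mat h i j)" for i j
  define cU where "cU \<omega> i = u \<omega> i + dt * (2 * v \<omega> i + 1/2 * dt * (1/2 * ?A (u \<omega>) i - u \<omega> i / 2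
      + p \<omega> i * p \<omega> i + q \<omega> i * q \<omega> i) + 1/2 * C2 * e2 i * b2 \<omega> + w \<omega> i)
      + 1/2 * dt * C2 * e2 i * b2 \<omega>" for \<omega> i
  \<comment> \<open>Inserting \<open>V\<close> into the equation for \<open>U\<close> multiplies
    \<open>dt\<close>, \<open>dt / 2\<close> and the \<open>1/2\<close> of the average, hence
    \<open>dt\<^sup>2 / 4\<close>. The identity part stems from the term
    \<open>- (U i + u i) / 2\<close>.\<close>
  have sum_kU: "(\<Sum>j\<in>?I. kU i j * z j) = dt\<^sup>2 / 4 * (z i - ?A z i)" if "i \<in> ?I" for z i
  proof -
    have "(\<Sum>j\<in>?I. kU i j * z j)
        = dt\<^sup>2 / 4 * ((\<Sum>j\<in>?I. if i = j then z j else 0) - (\<Sum>j\<in>?I. lap_mat h i j * z j))"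
      unfolding sum_subtractf[symmetric] sum_distrib_left
      by (intro sum.cong refl) (simp add: kU_def algebra_simps)
    then show ?thesis using that by (simp add: mat_vec_def)
  qed
  obtain U' where U'_meas [measurable]: "\<And>i. i \<in> ?I \<Longrightarrow> (\<lambda>\<omega>. U' \<omega> i) \<in> borel_measurable M"
    and U': "\<And>\<omega> z i. \<omega> \<in> space M \<Longrightarrow> (\<And>i. i \<in> ?I \<Longrightarrow> z i + (\<Sum>j\<in>?I. kU i j * z j) = cU \<omega> i) \<Longrightarrow>
           i \<in> ?I \<Longrightarrow> z i = U' \<omega> i"
  proof (rule psd_solution_measurable[of ?I "\<lambda>\<omega>. kU" M cU])
    show "(\<lambda>\<omega>. cU \<omega> i) \<in> borel_measurable M" if "i \<in> ?I" for i
      unfolding cU_def using that by measurable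
    show "0 \<le> (\<Sum>i\<in>?I. \<Sum>j\<in>?I. kU i j * d j * d i)" for d
    proof -
      have "(\<Sum>i\<in>?I. \<Sum>j\<in>?I. kU i j * d j * d i) = (\<Sum>i\<in>?I. dt\<^sup>2 / 4 * (d i - ?A d i) * d i)"
        unfolding sum_distrib_right[symmetric] by (intro sum.cong refl) (simp only: sum_kU)
      also have "\<dots> = dt\<^sup>2 / 4 * ((\<Sum>i\<in>?I. d i * d i) - (\<Sum>i\<in>?I. \<Sum>j\<in>?I. lap_mat h i j * d j * d i))"
        unfolding sum_subtractf[symmetric] sum_distrib_left[of "dt\<^sup>2 / 4"]
        by (intro sum.cong refl) (simp add: mat_vec_def sum_distrib_right sum_distrib_left algebra_simps)
      also have "\<dots> \<ge> 0"
        using lap_mat_nsd[where m=m and h=h and f=d] sum_nonneg[of ?I "\<lambda>i. d i * d i"] by (intro mult_nonneg_nonneg) auto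
      finally show ?thesis .
    qed
  qed auto
  define V' where "V' \<omega> i = v \<omega> i + 1/2 * dt * (?A (\<lambda>j. (U' \<omega> j + u \<omega> j) / 2) i
      - (U' \<omega> i + u \<omega> i) / 2 + p \<omega> i * p \<omega> i + q \<omega> i * q \<omega> i) + 1/2 * C2 * e2 i * b2 \<omega> + w \<omega> i" for \<omega> i
  text \<open>The index \<open>True\<close> stands for the \<open>P\<close>-component, \<open>False\<close> for the \<open>Q\<close>-component.\<close>
  define kPQ where "kPQ \<omega> = (\<lambda>(s, i) (s', j). if s = s' then 0 else
      (if s then dt / 2 else - (dt / 2)) * (lap_mat h i j + (if i = j then U' \<omega> i else 0)))" for \<omega>
  define p' where "p' \<omega> i = p \<omega> i + C1 * e1 i * b1 \<omega>" for \<omega> i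
  define q' where "q' \<omega> i = q \<omega> i - C1 * e1 i * b0 \<omega>" for \<omega> i
  have [measurable]: "(\<lambda>\<omega>. p' \<omega> i) \<in> borel_measurable M" "(\<lambda>\<omega>. q' \<omega> i) \<in> borel_measurable M"
    if "i \<in> ?I" for i
    unfolding p'_def q'_def using that by measurable
  \<comment> \<open>Right-hand side of \<open>P - p' = - dt/2 L (Q + q')\<close> and of its
    companion once the unknowns are moved to the left, with \<open>U'\<close> in place of
    \<open>U\<close>.\<close>
  define cPQ where "cPQ \<omega> = (\<lambda>(s, i). if s then p' \<omega> i - dt / 2 * (?A (q' \<omega>) i + U' \<omega> i * q' \<omega> i)
      else q' \<omega> i + dt / 2 * (?A (p' \<omega>) i + U' \<omega> i * p' \<omega> i))" for \<omega>
  have sum_L: "(\<Sum>j\<in>?I. (lap_mat h i j + (if i = j then U' \<omega> i else 0)) * z j) = ?A z i + U' \<omega> i * z i"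
    if "i \<in> ?I" for z i \<omega>
  proof -
    have "(\<Sum>j\<in>?I. (lap_mat h i j + (if i = j then U' \<omega> i else 0)) * z j)
        = (\<Sum>j\<in>?I. lap_mat h i j * z j + (if i = j then U' \<omega> i * z i else 0))"
      by (intro sum.cong refl) (simp add: algebra_simps)
    then show ?thesis using that by (simp add: mat_vec_def sum.distrib)
  qed
  have sum_kPQ: "(\<Sum>x\<in>UNIV \<times> ?I. kPQ \<omega> (s, i) x * z x)
      = (if s then dt / 2 else - (dt / 2)) * (?A (\<lambda>j. z (\<not> s, j)) i + U' \<omega> i * z (\<not> s, i))"
    if "i \<in> ?I" for s z i \<omega>
  proof -
    have "(\<Sum>x\<in>UNIV \<times> ?I. kPQ \<omega> (s, i) x * z x) = (\<Sum>s'\<in>UNIV. \<Sum>j\<in>?I. kPQ \<omega> (s, i) (s', j) * z (s', j))"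
      by (simp add: sum.cartesian_product case_prod_unfold)
    also have "\<dots> = (if s then dt / 2 else - (dt / 2))
        * (\<Sum>j\<in>?I. (lap_mat h i j + (if i = j then U' \<omega> i else 0)) * z (\<not> s, j))"
      unfolding sum_distrib_left by (cases s) (simp_all add: UNIV_bool kPQ_def mult.assoc)
    finally show ?thesis using sum_L[OF that] by simp
  qed
  obtain s where s_meas: "\<And>x. x \<in> UNIV \<times> ?I \<Longrightarrow> (\<lambda>\<omega>. s \<omega> x) \<in> borel_measurable M"
    and s: "\<And>\<omega> z x. \<omega> \<in> space M \<Longrightarrow>
      (\<And>x. x \<in> UNIV \<times> ?I \<Longrightarrow> z x + (\<Sum>y\<in>UNIV \<times> ?I. kPQ \<omega> x y * z y) = cPQ \<omega> x) \<Longrightarrow>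
      x \<in> UNIV \<times> ?I \<Longrightarrow> z x = s \<omega> x"
  proof (rule psd_solution_measurable[of "UNIV \<times> ?I" kPQ M cPQ])
    show "(\<lambda>\<omega>. kPQ \<omega> x y) \<in> borel_measurable M" if "x \<in> UNIV \<times> ?I" "y \<in> UNIV \<times> ?I" for x y
      unfolding kPQ_def using that by (cases x; cases y) (auto simp: split_beta intro!: U'_meas borel_measurable_add borel_measurable_times)
    show "(\<lambda>\<omega>. cPQ \<omega> x) \<in> borel_measurable M" if "x \<in> UNIV \<times> ?I" for x
    proof (cases x)
      case (Pair s i)
      then have "i \<in> ?I" using that by auto
      then show ?thesis unfolding cPQ_def Pair by (cases s) simp_all
    qed
    \<comment> \<open>The form vanishes: the two blocks carry opposite signs, so the
      \<open>U'\<close> terms cancel pointwise and the \<open>A\<close> terms by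
      self-adjointness.\<close>
    show "0 \<le> (\<Sum>x\<in>UNIV \<times> ?I. \<Sum>y\<in>UNIV \<times> ?I. kPQ \<omega> x y * d y * d x)" for \<omega> and d :: "bool \<times> nat \<Rightarrow> real"
    proof -
      have "(\<Sum>x\<in>UNIV \<times> ?I. \<Sum>y\<in>UNIV \<times> ?I. kPQ \<omega> x y * d y * d x)
          = (\<Sum>s\<in>UNIV. \<Sum>i\<in>?I. (if s then dt / 2 else - (dt / 2))
              * (?A (\<lambda>j. d (\<not> s, j)) i + U' \<omega> i * d (\<not> s, i)) * d (s, i))"
        unfolding sum_distrib_right[symmetric] sum.cartesian_product
        by (intro sum.cong refl) (auto simp: sum_kPQ simp del: One_nat_def)
      also have "\<dots> = dt / 2 * ((\<Sum>i\<in>?I. ?A (\<lambda>j. d (False, j)) i * d (True, i))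
          - (\<Sum>i\<in>?I. ?A (\<lambda>j. d (True, j)) i * d (False, i)))"
        unfolding sum_subtractf[symmetric] sum_distrib_left
        by (simp add: UNIV_bool sum.distrib[symmetric] algebra_simps)
      also have "\<dots> = 0"
        by (subst lap_mat_self_adjoint) simp
      finally show ?thesis by simp
    qed
  qed auto
  show thesis
  proof (rule that[of "\<lambda>\<omega> i. s \<omega> (True, i)" "\<lambda>\<omega> i. s \<omega> (False, i)" U' V'])
    fix \<omega> P Q U V i
    assume \<omega>: "\<omega> \<in> space M" and i: "i \<in> ?I"
      and step: "kgs_step m h dt C1 C2 e1 e2 (b0 \<omega>) (b1 \<omega>) (b2 \<omega>) (p \<omega>) (q \<omega>) (u \<omega>) (v \<omega>) P Q U V"
    have P: "P i = p \<omega> i - dt * (?A (\<lambda>j. (Q j + q \<omega> j) / 2) i + 1/2 * U i * (Q i + q \<omega> i))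
          + C1 * e1 i * b1 \<omega> + 1/2 * dt * C1 * b0 \<omega> * (?A e1 i + U i * e1 i)"
      and Q: "Q i = q \<omega> i + dt * (?A (\<lambda>j. (P j + p \<omega> j) / 2) i + 1/2 * U i * (P i + p \<omega> i))
          - C1 * e1 i * b0 \<omega> + 1/2 * dt * C1 * b1 \<omega> * (?A e1 i + U i * e1 i)"
      and V: "V i = v \<omega> i + 1/2 * dt * (?A (\<lambda>j. (U j + u \<omega> j) / 2) i
      - (U i + u \<omega> i) / 2 + p \<omega> i * p \<omega> i + q \<omega> i * q \<omega> i) + 1/2 * C2 * e2 i * b2 \<omega> + w \<omega> i"
      and U: "U i = u \<omega> i + dt * (V i + v \<omega> i) + 1/2 * dt * C2 * e2 i * b2 \<omega>"
      if "i \<in> ?I" for i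
      unfolding w_def using kgs_stepD[OF step that] by blast+
    have half: "?A (\<lambda>j. (f j + g j) / 2) i = 1/2 * ?A f i + 1/2 * ?A g i" for f g i
      by (simp add: mat_vec_def add_divide_distrib algebra_simps sum.distrib sum_divide_distrib)
    \<comment> \<open>\<open>U\<close> is identified first, since the matrix of the
      \<open>(P, Q)\<close> system is built from \<open>U'\<close>.\<close>
    have UU: "U i = U' \<omega> i" if "i \<in> ?I" for i
    proof (rule U'[OF \<omega> _ that])
      fix i assume i: "i \<in> ?I"
      show "U i + (\<Sum>j\<in>?I. kU i j * U j) = cU \<omega> i"
        unfolding sum_kU[OF i] cU_def
        using U[OF i] unfolding V[OF i] half by (simp add: field_simps power2_eq_square)
    qed
    have VV: "V i = V' \<omega> i"
      using V[OF i] mat_vec_cong[of m "\<lambda>j. (U j + u \<omega> j) / 2" "\<lambda>j. (U' \<omega> j + u \<omega> j) / 2"] UU i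
      by (simp add: V'_def)
    define z where "z = (\<lambda>(s, i). if s then P i else Q i)"
    have Ap: "?A (p' \<omega>) i = ?A (p \<omega>) i + C1 * b1 \<omega> * ?A e1 i"
      and Aq: "?A (q' \<omega>) i = ?A (q \<omega>) i - C1 * b0 \<omega> * ?A e1 i" for i
      by (simp_all add: mat_vec_def p'_def q'_def algebra_simps sum.distrib sum_distrib_left sum_subtractf)
    have PQ: "z x = s \<omega> x" if "x \<in> UNIV \<times> ?I" for x
    proof (rule s[OF \<omega> _ that])
      fix x :: "bool \<times> nat" assume x: "x \<in> UNIV \<times> ?I"
      obtain s i where si: "x = (s, i)" "i \<in> ?I" using x by auto
      note eqs = P[OF si(2)] Q[OF si(2)] 
      show "z x + (\<Sum>y\<in>UNIV \<times> ?I. kPQ \<omega> x y * z y) = cPQ \<omega> x"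
      proof (cases s)
        case True
        show ?thesis
          unfolding si(1) sum_kPQ[OF si(2)]
          using True eqs(1) UU[OF si(2)]
          by (simp add: z_def cPQ_def half Aq p'_def q'_def field_simps)
      next
        case False
        show ?thesis
          unfolding si(1) sum_kPQ[OF si(2)]
          using False eqs(2) UU[OF si(2)]
          by (simp add: z_def cPQ_def half Ap p'_def q'_def field_simps)
      qed
    qed
    show "P i = s \<omega> (True, i) \<and> Q i = s \<omega> (False, i) \<and> U i = U' \<omega> i \<and> V i = V' \<omega> i"
      using PQ[of "(True, i)"] PQ[of "(False, i)"] UU[OF i] VV i by (simp add: z_def)
  next
    show "(\<lambda>\<omega>. V' \<omega> i) \<in> borel_measurable M" if "i \<in> ?I" for i
      unfolding V'_def using that by measurable
  qed (use s_meas U'_meas in auto)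
qed

section \<open>Independence and moments of the Wiener increments\<close>

context prob_space
begin

text \<open>A finite set of index pairs is sorted by first component, and the events of one block
  are merged into a single event \<open>E k\<close> for \<open>Y k\<close>. The probability then
  factors first over the blocks and next inside each block.\<close>

lemma indep_vars_Sigma:
  assumes K: "finite K" and J: "\<And>k. k \<in> K \<Longrightarrow> finite (J k)"
    and Y: "indep_vars N Y K"
    and f: "\<And>k j. k \<in> K \<Longrightarrow> j \<in> J k \<Longrightarrow> f k j \<in> measurable (N k) (L k j)"
    and X: "\<And>k. k \<in> K \<Longrightarrow> indep_vars (L k) (\<lambda>j \<omega>. f k j (Y k \<omega>)) (J k)"
  shows "indep_vars (\<lambda>(k, j). L k j) (\<lambda>(k, j) \<omega>. f k j (Y k \<omega>)) (Sigma K J)"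
proof -
  have Ym: "Y k \<in> measurable M (N k)" if "k \<in> K" for k
    using Y that by (auto simp: indep_vars_def2)
  have rv: "(case i of (k, j) \<Rightarrow> \<lambda>\<omega>. f k j (Y k \<omega>)) \<in> measurable M (case i of (k, j) \<Rightarrow> L k j)"
    if "i \<in> Sigma K J" for i
    using that measurable_compose[OF Ym f] by auto
  show ?thesis
    unfolding indep_vars_def2
  proof (intro conjI ballI)
    show "indep_sets (\<lambda>i. {(case i of (k, j) \<Rightarrow> \<lambda>\<omega>. f k j (Y k \<omega>)) -` A \<inter> space M |A.
        A \<in> sets (case i of (k, j) \<Rightarrow> L k j)}) (Sigma K J)"
    proof (rule indep_setsI)
      fix i assume "i \<in> Sigma K J"
      with rv[OF this] show "{(case i of (k, j) \<Rightarrow> \<lambda>\<omega>. f k j (Y k \<omega>)) -` A \<inter> space M |A.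
          A \<in> sets (case i of (k, j) \<Rightarrow> L k j)} \<subseteq> events"
        by (auto intro: measurable_sets)
    next
      fix A S
      assume S: "S \<noteq> {}" "S \<subseteq> Sigma K J" "finite S"
        and "\<forall>i\<in>S. A i \<in> {(case i of (k, j) \<Rightarrow> \<lambda>\<omega>. f k j (Y k \<omega>)) -` A \<inter> space M |A.
          A \<in> sets (case i of (k, j) \<Rightarrow> L k j)}"
      then have "\<forall>i\<in>S. \<exists>C. A i = (case i of (k, j) \<Rightarrow> \<lambda>\<omega>. f k j (Y k \<omega>)) -` C \<inter> space M \<and>
          C \<in> sets (case i of (k, j) \<Rightarrow> L k j)" by auto
      from bchoice[OF this] obtain C where
        A: "\<And>k j. (k, j) \<in> S \<Longrightarrow> A (k, j) = (\<lambda>\<omega>. f k j (Y k \<omega>)) -` C (k, j) \<inter> space M"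
        and C: "\<And>k j. (k, j) \<in> S \<Longrightarrow> C (k, j) \<in> sets (L k j)"
        by fastforce
      \<comment> \<open>Only blocks with a selected pair are kept: an intersection over an empty
        fibre would be the whole type instead of an event.\<close>
      define K' where "K' = fst ` S"
      define J' where "J' k = {j. (k, j) \<in> S}" for k
      have S_eq: "S = Sigma K' J'" by (force simp: K'_def J'_def)
      have K': "K' \<subseteq> K" "K' \<noteq> {}" "finite K'" and J': "\<And>k. k \<in> K' \<Longrightarrow> J' k \<noteq> {} \<and> J' k \<subseteq> J k"
        using S by (auto simp: K'_def J'_def)
      have finJ': "finite (J' k)" if "k \<in> K'" for k
        using J' J K' that by (meson finite_subset subsetD)
      define E where "E k = (\<Inter>j\<in>J' k. f k j -` C (k, j) \<inter> space (N k))" for k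
      have E: "E k \<in> sets (N k)" if "k \<in> K'" for k
        unfolding E_def
      proof (intro sets.finite_INT finJ' that)
        show "J' k \<noteq> {}" using J' that by auto
        show "f k j -` C (k, j) \<inter> space (N k) \<in> sets (N k)" if "j \<in> J' k" for j
          using that \<open>k \<in> K'\<close> J' K' by (intro measurable_sets[OF f] C) (auto simp: S_eq)
      qed
      have E_vimage: "Y k -` E k \<inter> space M = (\<Inter>j\<in>J' k. A (k, j))" if "k \<in> K'" for k
        using J'[OF that] K' that measurable_space[OF Ym[of k]] by (auto simp: E_def A S_eq)
      have "(\<Inter>i\<in>S. A i) = (\<Inter>k\<in>K'. Y k -` E k \<inter> space M)"
        unfolding S_eq by (auto simp: E_vimage)
      then have "prob (\<Inter>i\<in>S. A i) = prob (\<Inter>k\<in>K'. Y k -` E k \<inter> space M)" by simp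
      also have "\<dots> = (\<Prod>k\<in>K'. prob (Y k -` E k \<inter> space M))"
        using K' E by (intro indep_varsD[OF Y]) auto
      also have "\<dots> = (\<Prod>k\<in>K'. \<Prod>j\<in>J' k. prob (A (k, j)))"
      proof (intro prod.cong refl)
        fix k assume k: "k \<in> K'"
        have "prob (Y k -` E k \<inter> space M)
            = prob (\<Inter>j\<in>J' k. (\<lambda>\<omega>. f k j (Y k \<omega>)) -` C (k, j) \<inter> space M)"
          using k by (simp add: E_vimage A S_eq)
        also have "\<dots> = (\<Prod>j\<in>J' k. prob ((\<lambda>\<omega>. f k j (Y k \<omega>)) -` C (k, j) \<inter> space M))"
          using k K' J' finJ' by (intro indep_varsD[OF X]) (auto intro!: C simp: S_eq)
        finally show "prob (Y k -` E k \<inter> space M) = (\<Prod>j\<in>J' k. prob (A (k, j)))"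
          using k by (simp add: A S_eq)
      qed
      also have "\<dots> = (\<Prod>i\<in>S. prob (A i))"
        unfolding S_eq using K' finJ' by (subst prod.Sigma) (auto simp: case_prod_unfold)
      finally show "prob (\<Inter>i\<in>S. A i) = (\<Prod>i\<in>S. prob (A i))" .
    qed
  qed (use rv in auto)
qed

text \<open>The blocks are the processes: an increment is a difference of two path coordinates,
  hence measurable on path space, and within one process the increments are independent.\<close>

lemma wiener_increments_indep:
  fixes B :: "'k \<Rightarrow> real \<Rightarrow> 'a \<Rightarrow> real"
  assumes K: "finite K" and B: "indep_processes M B K" "\<And>k. k \<in> K \<Longrightarrow> std_wiener M (B k)"
    and t: "0 \<le> t 0" "\<And>j. t j \<le> t (Suc j)"
  shows "indep_vars (\<lambda>_. borel) (\<lambda>(k, j) \<omega>. B k (t (Suc j)) \<omega> - B k (t j) \<omega>) (K \<times> {..<n})"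
proof -
  have t_nn: "0 \<le> t j" for j
    by (induction j) (auto intro: t(1) order_trans[OF _ t(2)])
  have "indep_vars (\<lambda>(k, j). borel) (\<lambda>(k, j) \<omega>. (\<lambda>y. y (t (Suc j)) - y (t j)) (\<lambda>s\<in>{0..}. B k s \<omega>))
      (K \<times> {..<n})"
  proof (rule indep_vars_Sigma[where N="\<lambda>_. Pi\<^sub>M {0..} (\<lambda>_. borel)" and L="\<lambda>_ _. borel"
        and Y="\<lambda>k \<omega>. \<lambda>s\<in>{0..}. B k s \<omega>" and f="\<lambda>k j y. y (t (Suc j)) - y (t j)"])
    show "indep_vars (\<lambda>_. Pi\<^sub>M {0..} (\<lambda>_. borel)) (\<lambda>k \<omega>. \<lambda>s\<in>{0..}. B k s \<omega>) K"
      using B(1) by (simp add: indep_processes_def)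
    show "indep_vars (\<lambda>_. borel)
        (\<lambda>j \<omega>. (\<lambda>s\<in>{0..}. B k s \<omega>) (t (Suc j)) - (\<lambda>s\<in>{0..}. B k s \<omega>) (t j)) {..<n}" if "k \<in> K" for k
      using B(2)[OF that] t t_nn by (auto simp: std_wiener_def)
    show "(\<lambda>y. y (t (Suc j)) - y (t j) :: real) \<in> borel_measurable (Pi\<^sub>M {0..} (\<lambda>_. borel))" for j
      using t_nn by (intro borel_measurable_diff measurable_component_singleton) auto
  qed (auto intro: K)
  then show ?thesis
    using t_nn by (simp add: case_prod_unfold)
qed

lemma wiener_increment_moments:
  assumes "std_wiener M B" and s: "0 \<le> s" "s < t"
  shows "integrable M (\<lambda>\<omega>. B t \<omega> - B s \<omega>)" and "expectation (\<lambda>\<omega>. B t \<omega> - B s \<omega>) = 0"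
    and "integrable M (\<lambda>\<omega>. (B t \<omega> - B s \<omega>)\<^sup>2)" and "expectation (\<lambda>\<omega>. (B t \<omega> - B s \<omega>)\<^sup>2) = t - s"
proof -
  have D: "distributed M lborel (\<lambda>\<omega>. B t \<omega> - B s \<omega>) (normal_density 0 (sqrt (t - s)))"
    using assms by (auto simp: std_wiener_def)
  have \<sigma>: "0 < sqrt (t - s)" using s by simp
  show *: "integrable M (\<lambda>\<omega>. B t \<omega> - B s \<omega>)"
    using integrable_normal_moment_nz_1[OF \<sigma>] by (intro distributed_integrable_var[OF D]) auto
  show E: "expectation (\<lambda>\<omega>. B t \<omega> - B s \<omega>) = 0"
    by (rule normal_distributed_expectation[OF \<sigma> D])
  show "integrable M (\<lambda>\<omega>. (B t \<omega> - B s \<omega>)\<^sup>2)"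
    using integrable_normal_moment[OF \<sigma>, of 0 2] distributed_integrable[OF D, of "\<lambda>x. x\<^sup>2"] by simp
  show "expectation (\<lambda>\<omega>. (B t \<omega> - B s \<omega>)\<^sup>2) = t - s"
    using normal_distributed_variance[OF \<sigma> D] s unfolding E by simp
qed

end

section \<open>Evolution of the expected charge\<close>

context prob_space
begin

text \<open>An explicit form of adaptedness, with the values at step \<open>n\<close> factored
  through the increments of index below \<open>n\<close>. Independence of \<open>X (k, n)\<close>
  can then be read off from disjoint index sets.\<close>

lemma kgs_scheme_adapted:
  fixes X :: "nat \<times> nat \<Rightarrow> 'a \<Rightarrow> real"
  assumes init: "AE \<omega> in M. \<forall>i\<in>{1..<m}.
        P 0 \<omega> i = P0 i \<and> Q 0 \<omega> i = Q0 i \<and> U 0 \<omega> i = U0 i \<and> V 0 \<omega> i = V0 i"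
    and scheme: "AE \<omega> in M. \<forall>n<N.
        kgs_step m h dt C1 C2 e1 e2 (X (0, n) \<omega>) (X (1, n) \<omega>) (X (2, n) \<omega>)
          (P n \<omega>) (Q n \<omega>) (U n \<omega>) (V n \<omega>)
          (P (Suc n) \<omega>) (Q (Suc n) \<omega>) (U (Suc n) \<omega>) (V (Suc n) \<omega>)"
    and "n \<le> N"
  shows "\<exists>p q u v.
      (\<forall>f\<in>{p, q, u, v}. \<forall>i\<in>{1..<m}.
        (\<lambda>y. f y i) \<in> borel_measurable (Pi\<^sub>M ({0, 1, 2} \<times> {..<n}) (\<lambda>_. borel))) \<and>
      (AE \<omega> in M. \<forall>i\<in>{1..<m}. let y = restrict (\<lambda>k. X k \<omega>) ({0, 1, 2} \<times> {..<n}) in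
        P n \<omega> i = p y i \<and> Q n \<omega> i = q y i \<and> U n \<omega> i = u y i \<and> V n \<omega> i = v y i)"
  using \<open>n \<le> N\<close>
proof (induction n)
  case 0
  \<comment> \<open>No increment is available yet; constants suffice because the initial vectors are
    deterministic.\<close>
  show ?case
    by (rule exI[of _ "\<lambda>_. P0"], rule exI[of _ "\<lambda>_. Q0"], rule exI[of _ "\<lambda>_. U0"],
        rule exI[of _ "\<lambda>_. V0"]) (use init in \<open>simp add: Let_def\<close>)
next
  case (Suc n)
  let ?J = "\<lambda>n. {0, 1, 2} \<times> {..<n} :: (nat \<times> nat) set"
  let ?M = "\<lambda>n. Pi\<^sub>M (?J n) (\<lambda>_. borel :: real measure)"
  let ?y = "\<lambda>n \<omega>. restrict (\<lambda>k. X k \<omega>) (?J n)"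
  obtain p q u v where
    meas: "\<forall>f\<in>{p, q, u, v}. \<forall>i\<in>{1..<m}. (\<lambda>y. f y i) \<in> borel_measurable (?M n)"
    and eq: "AE \<omega> in M. \<forall>i\<in>{1..<m}. let y = ?y n \<omega> in
        P n \<omega> i = p y i \<and> Q n \<omega> i = q y i \<and> U n \<omega> i = u y i \<and> V n \<omega> i = v y i"
    using Suc.IH[OF Suc_leD[OF Suc.prems]] by blast
  have restr: "(\<lambda>y. restrict y (?J n)) \<in> measurable (?M (Suc n)) (?M n)"
    by (rule measurable_restrict_subset) auto
  have meas': "(\<lambda>y. f (restrict y (?J n)) i) \<in> borel_measurable (?M (Suc n))"
    if "f \<in> {p, q, u, v}" "i \<in> {1..<m}" for f i
    using measurable_compose[OF restr, of "\<lambda>y. f y i"] meas that by blast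
  have comp: "(\<lambda>y. y (k, n)) \<in> borel_measurable (?M (Suc n))" if "k \<in> {0, 1, 2}" for k
    using that by (intro measurable_component_singleton) auto
  obtain P' Q' U' V' where
    meas_new: "\<And>i. i \<in> {1..<m} \<Longrightarrow> (\<lambda>y. P' y i) \<in> borel_measurable (?M (Suc n))"
      "\<And>i. i \<in> {1..<m} \<Longrightarrow> (\<lambda>y. Q' y i) \<in> borel_measurable (?M (Suc n))"
      "\<And>i. i \<in> {1..<m} \<Longrightarrow> (\<lambda>y. U' y i) \<in> borel_measurable (?M (Suc n))"
      "\<And>i. i \<in> {1..<m} \<Longrightarrow> (\<lambda>y. V' y i) \<in> borel_measurable (?M (Suc n))"
    and new: "\<And>y P Q U V i. y \<in> space (?M (Suc n)) \<Longrightarrow>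
       kgs_step m h dt C1 C2 e1 e2 (y (0, n)) (y (1, n)) (y (2, n))
         (p (restrict y (?J n))) (q (restrict y (?J n)))
         (u (restrict y (?J n))) (v (restrict y (?J n))) P Q U V \<Longrightarrow>
       i \<in> {1..<m} \<Longrightarrow> P i = P' y i \<and> Q i = Q' y i \<and> U i = U' y i \<and> V i = V' y i"
    by (rule kgs_step_solution_measurable[where M="?M (Suc n)" and m=m and h=h and dt=dt
        and ?C1.0=C1 and ?C2.0=C2 and ?e1.0=e1 and ?e2.0=e2
        and p="\<lambda>y. p (restrict y (?J n))" and q="\<lambda>y. q (restrict y (?J n))"
        and u="\<lambda>y. u (restrict y (?J n))" and v="\<lambda>y. v (restrict y (?J n))"
        and ?b0.0="\<lambda>y. y (0, n)" and ?b1.0="\<lambda>y. y (1, n)" and ?b2.0="\<lambda>y. y (2, n)"])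
      (use meas' comp in blast)+
  have "AE \<omega> in M. \<forall>i\<in>{1..<m}. let y = ?y (Suc n) \<omega> in
      P (Suc n) \<omega> i = P' y i \<and> Q (Suc n) \<omega> i = Q' y i \<and> U (Suc n) \<omega> i = U' y i \<and> V (Suc n) \<omega> i = V' y i"
    using eq scheme
  proof eventually_elim
    case (elim \<omega>)
    let ?z = "?y (Suc n) \<omega>"
    have z: "restrict ?z (?J n) = ?y n \<omega>" by (auto simp: restrict_def fun_eq_iff)
    have zn: "?z (0, n) = X (0, n) \<omega>" "?z (1, n) = X (1, n) \<omega>" "?z (2, n) = X (2, n) \<omega>" by simp_all
    have "kgs_step m h dt C1 C2 e1 e2 (X (0, n) \<omega>) (X (1, n) \<omega>) (X (2, n) \<omega>)
          (P n \<omega>) (Q n \<omega>) (U n \<omega>) (V n \<omega>)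
          (P (Suc n) \<omega>) (Q (Suc n) \<omega>) (U (Suc n) \<omega>) (V (Suc n) \<omega>)"
      using elim(2) Suc.prems by auto
    also have "?this \<longleftrightarrow> kgs_step m h dt C1 C2 e1 e2 (?z (0, n)) (?z (1, n)) (?z (2, n))
          (p (restrict ?z (?J n))) (q (restrict ?z (?J n)))
          (u (restrict ?z (?J n))) (v (restrict ?z (?J n)))
          (P (Suc n) \<omega>) (Q (Suc n) \<omega>) (U (Suc n) \<omega>) (V (Suc n) \<omega>)"
      unfolding z zn using elim(1) by (intro kgs_step_cong) (auto simp: Let_def)
    finally show ?case
      using new[of ?z "P (Suc n) \<omega>" "Q (Suc n) \<omega>" "U (Suc n) \<omega>" "V (Suc n) \<omega>"]
      by (auto simp: Let_def space_PiM)
  qed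
  moreover have "\<forall>f\<in>{P', Q', U', V'}. \<forall>i\<in>{1..<m}. (\<lambda>y. f y i) \<in> borel_measurable (?M (Suc n))"
    using meas_new by blast
  ultimately show ?case by blast
qed

lemma integrable_charge_component:
  assumes h: "0 < h" and i: "i \<in> {1..<m}"
    and [measurable]: "(\<lambda>\<omega>. p \<omega> i) \<in> borel_measurable M" "(\<lambda>\<omega>. q \<omega> i) \<in> borel_measurable M"
    and int: "integrable M (\<lambda>\<omega>. charge m h (p \<omega>) (q \<omega>))"
  shows "integrable M (\<lambda>\<omega>. (p \<omega> i)\<^sup>2)" and "integrable M (\<lambda>\<omega>. (q \<omega> i)\<^sup>2)"
proof -
  have le: "(p \<omega> i)\<^sup>2 + (q \<omega> i)\<^sup>2 \<le> charge m h (p \<omega>) (q \<omega>) / h" for \<omega>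
    using h i member_le_sum[of i "{1..<m}" "\<lambda>i. (p \<omega> i)\<^sup>2 + (q \<omega> i)\<^sup>2"] by (simp add: charge_eq)
  have bound: "norm ((p \<omega> i)\<^sup>2) \<le> norm (charge m h (p \<omega>) (q \<omega>) / h)"
    "norm ((q \<omega> i)\<^sup>2) \<le> norm (charge m h (p \<omega>) (q \<omega>) / h)" for \<omega>
    using le[of \<omega>] zero_le_power2[of "p \<omega> i"] zero_le_power2[of "q \<omega> i"]
    unfolding real_norm_def by linarith+
  have int': "integrable M (\<lambda>\<omega>. charge m h (p \<omega>) (q \<omega>) / h)" using int by simp
  show "integrable M (\<lambda>\<omega>. (p \<omega> i)\<^sup>2)"
    by (rule Bochner_Integration.integrable_bound[OF int' _ AE_I2[OF bound(1)]]) simp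
  show "integrable M (\<lambda>\<omega>. (q \<omega> i)\<^sup>2)"
    by (rule Bochner_Integration.integrable_bound[OF int' _ AE_I2[OF bound(2)]]) simp
qed

text \<open>Expanding the squares leaves cross terms \<open>p i * b1\<close> and
  \<open>q i * b0\<close>, whose means factor by independence and vanish, and the squares of
  \<open>b0\<close> and \<open>b1\<close>, each of mean \<open>dt\<close>.\<close>

lemma expectation_charge_perturbed:
  fixes b0 b1 :: "'a \<Rightarrow> real"
  assumes h: "0 < h"
    and meas: "\<And>i. i \<in> {1..<m} \<Longrightarrow> (\<lambda>\<omega>. p \<omega> i) \<in> borel_measurable M"
      "\<And>i. i \<in> {1..<m} \<Longrightarrow> (\<lambda>\<omega>. q \<omega> i) \<in> borel_measurable M"
    and int: "integrable M (\<lambda>\<omega>. charge m h (p \<omega>) (q \<omega>))"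
    and indep: "\<And>i. i \<in> {1..<m} \<Longrightarrow> indep_var borel (\<lambda>\<omega>. p \<omega> i) borel b1"
      "\<And>i. i \<in> {1..<m} \<Longrightarrow> indep_var borel (\<lambda>\<omega>. q \<omega> i) borel b0"
    and b: "integrable M b0" "integrable M b1" "expectation b0 = 0" "expectation b1 = 0"
      "integrable M (\<lambda>\<omega>. (b0 \<omega>)\<^sup>2)" "integrable M (\<lambda>\<omega>. (b1 \<omega>)\<^sup>2)"
      "expectation (\<lambda>\<omega>. (b0 \<omega>)\<^sup>2) = dt" "expectation (\<lambda>\<omega>. (b1 \<omega>)\<^sup>2) = dt"
  shows "has_bochner_integral M
      (\<lambda>\<omega>. charge m h (\<lambda>i. p \<omega> i + C1 * e1 i * b1 \<omega>) (\<lambda>i. q \<omega> i - C1 * e1 i * b0 \<omega>))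
      (expectation (\<lambda>\<omega>. charge m h (p \<omega>) (q \<omega>)) + 2 * C1\<^sup>2 * (norm_h m h e1)\<^sup>2 * dt)"
proof -
  let ?I = "{1..<m}"
  have cross: "has_bochner_integral M (\<lambda>\<omega>. p \<omega> i * b1 \<omega>) 0"
    "has_bochner_integral M (\<lambda>\<omega>. q \<omega> i * b0 \<omega>) 0" if "i \<in> ?I" for i
  proof -
    have sq: "integrable M (\<lambda>\<omega>. (p \<omega> i)\<^sup>2)" "integrable M (\<lambda>\<omega>. (q \<omega> i)\<^sup>2)"
      using integrable_charge_component[OF h that meas[OF that] int] .
    have *: "integrable M (\<lambda>\<omega>. p \<omega> i)" "integrable M (\<lambda>\<omega>. q \<omega> i)"
      using sq meas[OF that] by (auto intro: square_integrable_imp_integrable)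
    show "has_bochner_integral M (\<lambda>\<omega>. p \<omega> i * b1 \<omega>) 0"
      using indep_var_integrable[OF indep(1)[OF that] *(1) b(2)]
        indep_var_lebesgue_integral[OF indep(1)[OF that] *(1) b(2)] b(4)
      by (simp add: has_bochner_integral_iff)
    show "has_bochner_integral M (\<lambda>\<omega>. q \<omega> i * b0 \<omega>) 0"
      using indep_var_integrable[OF indep(2)[OF that] *(2) b(1)]
        indep_var_lebesgue_integral[OF indep(2)[OF that] *(2) b(1)] b(3)
      by (simp add: has_bochner_integral_iff)
  qed
  have sqs: "has_bochner_integral M (\<lambda>\<omega>. (b0 \<omega>)\<^sup>2) dt" "has_bochner_integral M (\<lambda>\<omega>. (b1 \<omega>)\<^sup>2) dt"
    using b by (simp_all add: has_bochner_integral_iff)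
  \<comment> \<open>The zero summands stay unsimplified, so that the value mirrors the integrand and
    the \<open>has_bochner_integral\<close> rules apply term by term.\<close>
  have lin: "has_bochner_integral M
      (\<lambda>\<omega>. charge m h (p \<omega>) (q \<omega>)
        + (\<Sum>i\<in>?I. 2 * h * C1 * e1 i * (p \<omega> i * b1 \<omega>) - 2 * h * C1 * e1 i * (q \<omega> i * b0 \<omega>)
          + h * C1\<^sup>2 * (e1 i)\<^sup>2 * ((b0 \<omega>)\<^sup>2 + (b1 \<omega>)\<^sup>2)))
      (expectation (\<lambda>\<omega>. charge m h (p \<omega>) (q \<omega>))
        + (\<Sum>i\<in>?I. 2 * h * C1 * e1 i * 0 - 2 * h * C1 * e1 i * 0 + h * C1\<^sup>2 * (e1 i)\<^sup>2 * (dt + dt)))"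
    by (intro has_bochner_integral_add has_bochner_integral_sum has_bochner_integral_diff
        has_bochner_integral_mult_right cross sqs has_bochner_integral_integrable int)
  have "(\<Sum>i\<in>?I. 2 * h * C1 * e1 i * 0 - 2 * h * C1 * e1 i * 0 + h * C1\<^sup>2 * (e1 i)\<^sup>2 * (dt + dt))
      = 2 * C1\<^sup>2 * (norm_h m h e1)\<^sup>2 * dt"
  proof -
    have "(norm_h m h e1)\<^sup>2 = h * (\<Sum>i\<in>?I. (e1 i)\<^sup>2)"
      using h by (simp add: norm_h_def inner_h_def sum_nonneg power2_eq_square)
    then show ?thesis by (simp add: sum_distrib_left sum_distrib_right mult_ac)
  qed
  moreover have "charge m h (\<lambda>i. p \<omega> i + C1 * e1 i * b1 \<omega>) (\<lambda>i. q \<omega> i - C1 * e1 i * b0 \<omega>)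
      = charge m h (p \<omega>) (q \<omega>)
        + (\<Sum>i\<in>?I. 2 * h * C1 * e1 i * (p \<omega> i * b1 \<omega>) - 2 * h * C1 * e1 i * (q \<omega> i * b0 \<omega>)
          + h * C1\<^sup>2 * (e1 i)\<^sup>2 * ((b0 \<omega>)\<^sup>2 + (b1 \<omega>)\<^sup>2))" for \<omega>
    unfolding charge_eq[OF less_imp_le[OF h]] sum_distrib_left sum.distrib[symmetric]
    by (intro sum.cong refl) (simp add: power2_eq_square algebra_simps)
  ultimately show ?thesis using lin by simp
qed

end

section \<open>Induction over the time steps\<close>

lemma charge_cong:
  assumes "\<And>i. i \<in> {1..<m} \<Longrightarrow> P i = P' i" "\<And>i. i \<in> {1..<m} \<Longrightarrow> Q i = Q' i"
  shows "charge m h P Q = charge m h P' Q'"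
  using assms by (simp add: charge_def norm_h_def inner_h_def)

theorem theorem3p3:
  fixes \<Omega> :: "'w measure"
    and a b T dt h C1 C2 :: real
    and m N :: nat
    and B :: "nat \<Rightarrow> real \<Rightarrow> 'w \<Rightarrow> real"
    and \<Delta>B :: "nat \<Rightarrow> nat \<Rightarrow> 'w \<Rightarrow> real"
    and \<phi>0 :: "real \<Rightarrow> complex"
    and u0 \<mu>0 \<eta>1 \<eta>2 :: "real \<Rightarrow> real"
    and x t :: "nat \<Rightarrow> real"
    and e1 e2 P0 Q0 U0 V0 :: "nat \<Rightarrow> real"
    and P Q U V :: "nat \<Rightarrow> 'w \<Rightarrow> nat \<Rightarrow> real"
  defines "h \<equiv> (b - a) / real m"
    and "x \<equiv> (\<lambda>i. a + real i * h)"
    and "N \<equiv> nat \<lfloor>T / dt\<rfloor>"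
    and "t \<equiv> (\<lambda>n. real n * dt)"
    and "\<Delta>B \<equiv> (\<lambda>k n \<omega>. B k (t n) \<omega> - B k (t (n - 1)) \<omega>)"
    and "e1 \<equiv> (\<lambda>i. \<eta>1 (x i))"
    and "e2 \<equiv> (\<lambda>i. \<eta>2 (x i))"
  assumes "prob_space \<Omega>"
    and "a < b" and "m > 0" and "T > 0" and "dt > 0"
    and wiener: "\<And>k. k \<in> {0, 1, 2} \<Longrightarrow> std_wiener \<Omega> (B k)"
    and indep: "indep_processes \<Omega> B {0, 1, 2}"
    and "H10_on a b \<phi>0" and "H10_on a b u0" and "L2_on a b \<mu>0"
    and "H10_on a b \<eta>1" and "L2_on a b \<eta>2"
    \<comment> \<open>the solution consists of random vectors\<close>
    and random: "\<And>n i. n \<le> N \<Longrightarrow> i \<in> {1..<m} \<Longrightarrow>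
          (\<lambda>\<omega>. P n \<omega> i) \<in> borel_measurable \<Omega> \<and> (\<lambda>\<omega>. Q n \<omega> i) \<in> borel_measurable \<Omega> \<and>
          (\<lambda>\<omega>. U n \<omega> i) \<in> borel_measurable \<Omega> \<and> (\<lambda>\<omega>. V n \<omega> i) \<in> borel_measurable \<Omega>"
    \<comment> \<open>deterministic initial vectors: arbitrary grid approximations of the real and
      imaginary parts of \<open>\<phi>0\<close>, of \<open>u0\<close> and of \<open>\<mu>0 / 2\<close>\<close>
    and init: "AE \<omega> in \<Omega>. \<forall>i\<in>{1..<m}.
          P 0 \<omega> i = P0 i \<and> Q 0 \<omega> i = Q0 i \<and> U 0 \<omega> i = U0 i \<and> V 0 \<omega> i = V0 i"
    and scheme: "AE \<omega> in \<Omega>. \<forall>n\<in>{1..N}.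
          kgs_step m h dt C1 C2 e1 e2 (\<Delta>B 0 n \<omega>) (\<Delta>B 1 n \<omega>) (\<Delta>B 2 n \<omega>)
            (P (n - 1) \<omega>) (Q (n - 1) \<omega>) (U (n - 1) \<omega>) (V (n - 1) \<omega>)
            (P n \<omega>) (Q n \<omega>) (U n \<omega>) (V n \<omega>)"
  shows "\<forall>n\<in>{0..N}.
           integrable \<Omega> (\<lambda>\<omega>. charge m h (P n \<omega>) (Q n \<omega>)) \<and>
           prob_space.expectation \<Omega> (\<lambda>\<omega>. charge m h (P n \<omega>) (Q n \<omega>)) =
             prob_space.expectation \<Omega> (\<lambda>\<omega>. charge m h (P 0 \<omega>) (Q 0 \<omega>))
               + 2 * C1\<^sup>2 * (norm_h m h e1)\<^sup>2 * t n"
proof -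
  interpret prob_space \<Omega> by fact
  have h: "0 < h" using \<open>a < b\<close> \<open>m > 0\<close> by (simp add: h_def)
  let ?J = "\<lambda>n. {0, 1, 2} \<times> {..<n} :: (nat \<times> nat) set"
  \<comment> \<open>Shift by one: \<open>X (k, n)\<close> is the increment
    \<open>\<Delta>B k (Suc n)\<close>, which drives the step from \<open>n\<close> to
    \<open>Suc n\<close>.\<close>
  define X where "X = (\<lambda>(k, n) \<omega>. B k (t (Suc n)) \<omega> - B k (t n) \<omega>)"
  have t: "0 \<le> t 0" "0 \<le> t n" "t n < t (Suc n)" "t (Suc n) - t n = dt" for n
    using \<open>dt > 0\<close> by (simp_all add: t_def algebra_simps)
  have step: "AE \<omega> in \<Omega>. \<forall>n<N.
        kgs_step m h dt C1 C2 e1 e2 (X (0, n) \<omega>) (X (1, n) \<omega>) (X (2, n) \<omega>)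
          (P n \<omega>) (Q n \<omega>) (U n \<omega>) (V n \<omega>)
          (P (Suc n) \<omega>) (Q (Suc n) \<omega>) (U (Suc n) \<omega>) (V (Suc n) \<omega>)"
    using scheme
  proof eventually_elim
    case (elim \<omega>)
    show ?case
    proof (intro allI impI)
      fix n assume "n < N"
      then show "kgs_step m h dt C1 C2 e1 e2 (X (0, n) \<omega>) (X (1, n) \<omega>) (X (2, n) \<omega>)
          (P n \<omega>) (Q n \<omega>) (U n \<omega>) (V n \<omega>)
          (P (Suc n) \<omega>) (Q (Suc n) \<omega>) (U (Suc n) \<omega>) (V (Suc n) \<omega>)"
        using bspec[OF elim, of "Suc n"] by (simp add: X_def \<Delta>B_def)
    qed
  qed
  have charge_meas: "(\<lambda>\<omega>. charge m h (P n \<omega>) (Q n \<omega>)) \<in> borel_measurable \<Omega>" if "n \<le> N" for n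
  proof -
    have "(\<lambda>\<omega>. P n \<omega> i) \<in> borel_measurable \<Omega>" "(\<lambda>\<omega>. Q n \<omega> i) \<in> borel_measurable \<Omega>"
      if "i \<in> {1..<m}" for i
      using random[OF \<open>n \<le> N\<close> that] by auto
    then show ?thesis
      unfolding charge_eq[OF less_imp_le[OF h]] by measurable
  qed
  \<comment> \<open>Integrability is carried through the induction, because the perturbation lemma
    presupposes it for the old charge.\<close>
  have main: "integrable \<Omega> (\<lambda>\<omega>. charge m h (P n \<omega>) (Q n \<omega>)) \<and>
      expectation (\<lambda>\<omega>. charge m h (P n \<omega>) (Q n \<omega>)) =
        expectation (\<lambda>\<omega>. charge m h (P 0 \<omega>) (Q 0 \<omega>)) + 2 * C1\<^sup>2 * (norm_h m h e1)\<^sup>2 * t n"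
    if "n \<le> N" for n
    using that
  proof (induction n)
    case 0
    have "AE \<omega> in \<Omega>. charge m h (P 0 \<omega>) (Q 0 \<omega>) = charge m h P0 Q0"
      using init by eventually_elim (auto intro: charge_cong)
    then have "integrable \<Omega> (\<lambda>\<omega>. charge m h (P 0 \<omega>) (Q 0 \<omega>))"
      using charge_meas[of 0] by (subst integrable_cong_AE) auto
    then show ?case by (simp add: t_def)
  next
    case (Suc n)
    obtain p q u v where
      meas: "\<forall>f\<in>{p, q, u, v}. \<forall>i\<in>{1..<m}. (\<lambda>y. f y i) \<in> borel_measurable (Pi\<^sub>M (?J n) (\<lambda>_. borel))"
      and eq: "AE \<omega> in \<Omega>. \<forall>i\<in>{1..<m}. let y = restrict (\<lambda>k. X k \<omega>) (?J n) in
        P n \<omega> i = p y i \<and> Q n \<omega> i = q y i \<and> U n \<omega> i = u y i \<and> V n \<omega> i = v y i"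
      using kgs_scheme_adapted[OF init step Suc_leD[OF Suc.prems]] by blast
    \<comment> \<open>Versions of \<open>P n\<close> and \<open>Q n\<close> that are exact functions
      of the past increments. Independence is shown for these, and the almost sure equality is used
      under the integral.\<close>
    define p' where "p' \<omega> = p (restrict (\<lambda>k. X k \<omega>) (?J n))" for \<omega>
    define q' where "q' \<omega> = q (restrict (\<lambda>k. X k \<omega>) (?J n))" for \<omega>
    have eq': "AE \<omega> in \<Omega>. \<forall>i\<in>{1..<m}. P n \<omega> i = p' \<omega> i \<and> Q n \<omega> i = q' \<omega> i"
      using eq by eventually_elim (auto simp: p'_def q'_def Let_def)
    have X_indep: "indep_vars (\<lambda>_. borel) X (?J (Suc n))"
      unfolding X_def using wiener t indep
      by (intro wiener_increments_indep) (auto intro: less_imp_le)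
    have f_indep: "indep_var borel (\<lambda>\<omega>. f (restrict (\<lambda>k. X k \<omega>) (?J n)) i) borel (X (k, n))"
      if "f \<in> {p, q}" "i \<in> {1..<m}" "k \<in> {0, 1, 2}" for f i k
    proof -
      have "indep_var (Pi\<^sub>M (?J n) (\<lambda>_. borel)) (\<lambda>\<omega>. restrict (\<lambda>k. X k \<omega>) (?J n))
          (Pi\<^sub>M {(k, n)} (\<lambda>_. borel)) (\<lambda>\<omega>. restrict (\<lambda>k. X k \<omega>) {(k, n)})"
        using that by (intro indep_var_restrict[OF X_indep]) auto
      then have "indep_var borel ((\<lambda>y. f y i) \<circ> (\<lambda>\<omega>. restrict (\<lambda>k. X k \<omega>) (?J n)))
          borel ((\<lambda>y. y (k, n)) \<circ> (\<lambda>\<omega>. restrict (\<lambda>k. X k \<omega>) {(k, n)}))"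
        by (rule indep_var_compose) (use meas that in auto)
      then show ?thesis by (simp add: comp_def)
    qed
    have meas': "(\<lambda>\<omega>. p' \<omega> i) \<in> borel_measurable \<Omega>" "(\<lambda>\<omega>. q' \<omega> i) \<in> borel_measurable \<Omega>"
      if "i \<in> {1..<m}" for i
      using f_indep[of p i 0] f_indep[of q i 0] that indep_var_rv1 by (auto simp: p'_def q'_def)
    have charge'_meas: "(\<lambda>\<omega>. charge m h (p' \<omega>) (q' \<omega>)) \<in> borel_measurable \<Omega>"
      unfolding charge_eq[OF less_imp_le[OF h]] using meas' by measurable
    have AE1: "AE \<omega> in \<Omega>. charge m h (P n \<omega>) (Q n \<omega>) = charge m h (p' \<omega>) (q' \<omega>)"
      using eq' by eventually_elim (auto intro: charge_cong)
    \<comment> \<open>The new \<open>U\<close>, which does depend on the fresh increments, is absent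
      from the right-hand side; this is where the pathwise charge balance pays off.\<close>
    have AE2: "AE \<omega> in \<Omega>. charge m h (P (Suc n) \<omega>) (Q (Suc n) \<omega>) =
        charge m h (\<lambda>i. p' \<omega> i + C1 * e1 i * X (1, n) \<omega>) (\<lambda>i. q' \<omega> i - C1 * e1 i * X (0, n) \<omega>)"
      using eq' step
    proof eventually_elim
      case (elim \<omega>)
      have "kgs_step m h dt C1 C2 e1 e2 (X (0, n) \<omega>) (X (1, n) \<omega>) (X (2, n) \<omega>)
          (P n \<omega>) (Q n \<omega>) (U n \<omega>) (V n \<omega>)
          (P (Suc n) \<omega>) (Q (Suc n) \<omega>) (U (Suc n) \<omega>) (V (Suc n) \<omega>)"
        using elim(2) Suc.prems by auto
      then have "charge m h (P (Suc n) \<omega>) (Q (Suc n) \<omega>) =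
          charge m h (\<lambda>i. P n \<omega> i + C1 * e1 i * X (1, n) \<omega>) (\<lambda>i. Q n \<omega> i - C1 * e1 i * X (0, n) \<omega>)"
        using h by (intro kgs_step_charge) auto
      also have "\<dots> = charge m h (\<lambda>i. p' \<omega> i + C1 * e1 i * X (1, n) \<omega>)
          (\<lambda>i. q' \<omega> i - C1 * e1 i * X (0, n) \<omega>)"
        using elim by (intro charge_cong) auto
      finally show ?case .
    qed
    have IH: "integrable \<Omega> (\<lambda>\<omega>. charge m h (P n \<omega>) (Q n \<omega>))"
      "expectation (\<lambda>\<omega>. charge m h (P n \<omega>) (Q n \<omega>)) =
        expectation (\<lambda>\<omega>. charge m h (P 0 \<omega>) (Q 0 \<omega>)) + 2 * C1\<^sup>2 * (norm_h m h e1)\<^sup>2 * t n"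
      using Suc by auto
    have int': "integrable \<Omega> (\<lambda>\<omega>. charge m h (p' \<omega>) (q' \<omega>))"
      using IH(1) integrable_cong_AE[OF charge_meas charge'_meas AE1] Suc.prems by simp
    have E': "expectation (\<lambda>\<omega>. charge m h (p' \<omega>) (q' \<omega>)) = expectation (\<lambda>\<omega>. charge m h (P n \<omega>) (Q n \<omega>))"
      using integral_cong_AE[OF charge_meas charge'_meas AE1] Suc.prems by simp
    note moments = wiener_increment_moments[OF wiener t(2)[of n] t(3)[of n], unfolded t(4)]
    have X_eq: "X (k, n) = (\<lambda>\<omega>. B k (t (Suc n)) \<omega> - B k (t n) \<omega>)" for k
      by (simp add: X_def)
    have perturbed: "has_bochner_integral \<Omega>
        (\<lambda>\<omega>. charge m h (\<lambda>i. p' \<omega> i + C1 * e1 i * X (1, n) \<omega>) (\<lambda>i. q' \<omega> i - C1 * e1 i * X (0, n) \<omega>))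
        (expectation (\<lambda>\<omega>. charge m h (p' \<omega>) (q' \<omega>)) + 2 * C1\<^sup>2 * (norm_h m h e1)\<^sup>2 * dt)"
    proof (rule expectation_charge_perturbed[OF h meas' int'])
      show "indep_var borel (\<lambda>\<omega>. p' \<omega> i) borel (X (1, n))" if "i \<in> {1..<m}" for i
        using f_indep[of p i 1] that by (simp add: p'_def)
      show "indep_var borel (\<lambda>\<omega>. q' \<omega> i) borel (X (0, n))" if "i \<in> {1..<m}" for i
        using f_indep[of q i 0] that by (simp add: q'_def)
    qed (auto simp: X_eq intro!: moments)
    have "has_bochner_integral \<Omega> (\<lambda>\<omega>. charge m h (P (Suc n) \<omega>) (Q (Suc n) \<omega>))
        (expectation (\<lambda>\<omega>. charge m h (p' \<omega>) (q' \<omega>)) + 2 * C1\<^sup>2 * (norm_h m h e1)\<^sup>2 * dt)"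
      using perturbed has_bochner_integral_cong_AE[OF charge_meas[OF Suc.prems]
          borel_measurable_has_bochner_integral[OF perturbed] AE2] by simp
    moreover have "t (Suc n) = t n + dt" using t(4)[of n] by simp
    ultimately show ?case
      unfolding E' IH(2) has_bochner_integral_iff by (simp add: algebra_simps)
  qed
  show ?thesis by (intro ballI main) simp
qed

end
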